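(* Let $\alpha=0$, $c\ge1$, $\epsilon>0$, $x^0\neq x^*$, and let $d(\Lambda_c)=\|\lambda^*\|+c$. Suppose the ACGD-S method (described in the context) is run with $R=d(\Lambda_c)/\|x^0-x^*\|$ and with outer-loop stepsizes, for $t\ge1$, $$\tau_t=\tfrac{t-1}2,\quad\eta_t=\frac{L(\Lambda_c)}{\tau_{t+1}},\quad\omega_t=t,\quad\theta_{t+1}=\omega_t/\omega_{t+1},$$ and inner-loop parameters in phase $t$ given, with $M_t=\|\nu^t\|$ if $\|\nu^t\|>0$ and $M_t=1$ otherwise, by $\Delta=R/L(\Lambda_c)$, $S_t=\lceil M_t\Delta t\rceil$, $\tilde M_t=S_t/(\Delta t)$, $\rho^{(t)}_1=\tilde M_t/\tilde M_{t-1}$ for $t\ge2$, $\rho^{(t)}_s=1$ if $s\ge2$ or $(s,t)=(1,1)$, $\beta^{(t)}_s=\tilde M_tR$, $\gamma^{(t)}_s=\tilde M_t/R$, $\delta^{(t)}_s=1$ for all $s\ge1$. Let $\bar M$ be an upper bound of $\max\{1,\|\nabla g(x)\|\}$ over the bounded neighborhood of $x^*$ in which the points $\underline x^t$ remain (so $M_t\le\bar M$ for all $t$). Then the total numbers of operations required by the method to find an $(\epsilon;\epsilon/c)$-optimal solution are bounded by $$N_\epsilon=O\Big(\sqrt{\tfrac{L(\Lambda_c)}{\epsilon}}\,\|x^0-x^*\|\Big)\ \text{first-order-oracle evaluations,}$$ $$C_\epsilon=O\Big(\sqrt{\tfrac{L(\Lambda_c)}{\epsilon}}\,\|x^0-x^*\|+\frac{d(\Lambda_c)\bar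 M}{L(\Lambda_c)\|x^0-x^*\|}+\frac{d(\Lambda_c)\bar M\|x^0-x^*\|}{\epsilon}\Big)\ \text{matrix-vector multiplications,}$$ with absolute constants.
   Context: Problem: $\min_{x\in X}\{F(x):=f(x)+u(x)\}$ subject to $g(x)\le 0$, where $X\subseteq\mathbb R^n$ is closed and convex, $f:\mathbb R^n\to\mathbb R$ and $g=(g_1,\dots,g_m):\mathbb R^n\to\mathbb R^m$ are convex (componentwise) and differentiable with Lipschitz continuous gradients, and $u$ is a convex, $\alpha$-strongly convex function, $\alpha\ge0$ (here $\alpha=0$). Norms are Euclidean (operator norm for matrices), $[\cdot]_+$ is the componentwise positive part, $\nabla g(x)$ is the $m\times n$ Jacobian. There is a KKT pair: $x^*\in X$ optimal, $\lambda^*\in\mathbb R^m_+$ with $-[\nabla f(x^* )+\sum_i\lambda_i^*\nabla g_i(x^* )+u']\in N_X(x^* )$ for some $u'\in\partial u(x^* )$, $g(x^* )\le0$, $\lambda^*_ig_i(x^* )=0$ for all $i$; $F_*=F(x^* )$. A point $x$ is $(\epsilon;\epsilon/c)$-optimal if $F(x)-F_*\le\epsilon$ and $\|[g(x)]_+\|\le\epsilon/c$. For $\lambda\in\mathbb R^m_+$, $L_\lambda$ is a Lipschitz constant on $\mathbb R^n$ of the gradient of $f+\sum_i\lambda_ig_i$; $L(\Lambda)=\sup_{\lambda\in\Lambda}L_\lambda$; $\Lambda_r=\{0\}\cup\{\lambda^*+\lambda:\lambda\in\mathbb R^m_+,\|\lambda\|\le r\}$. Complexity bounds concern the nontrivial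 regime in which $x^0$ does not already satisfy the termination criterion. ACGD-S method: $x^{-1}=\underline x^0=y^{(1)}_0=x^0\in X$, $\pi^0=\nabla f(x^0)$, $\nu^0=\nabla g(x^0)$, $\lambda^{(1)}_{-1}=\lambda^{(1)}_0=0$. For phases $t=1,\dots,N$: 1. $\tilde x^t=x^{t-1}+\theta_t(x^{t-1}-x^{t-2})$, $\underline x^t=(\tau_t\underline x^{t-1}+\tilde x^t)/(1+\tau_t)$, $\pi^t=\nabla f(\underline x^t)$, $\nu^t=\nabla g(\underline x^t)$; compute $S_t$ and the inner parameters. 2. For $s=1,\dots,S_t$: $\tilde h^{(t),s}=(\nu^t)^\top\lambda^{(t)}_0+\rho^{(t)}_1(\nu^{t-1})^\top(\lambda^{(t)}_0-\lambda^{(t)}_{-1})$ if $s=1$, and $\tilde h^{(t),s}=(\nu^t)^\top\lambda^{(t)}_{s-1}+\rho^{(t)}_s(\nu^t)^\top(\lambda^{(t)}_{s-1}-\lambda^{(t)}_{s-2})$ otherwise; $y^{(t)}_s=\operatorname{argmin}_{y\in X}\langle\tilde h^{(t),s}+\pi^t,y\rangle+u(y)+\frac{\eta_t}2\|y-x^{t-1}\|^2+\frac{\beta^{(t)}_s}2\|y-y^{(t)}_{s-1}\|^2$; $\lambda^{(t)}_s=\operatorname{argmax}_{\lambda\in\mathbb R^m_+}\langle\lambda,\nu^t(y^{(t)}_s-\underline x^t)+g(\underline x^t)\rangle-\frac{\gamma^{(t)}_s}2\|\lambda-\lambda^{(t)}_{s-1}\|^2$. 3. $\lambda^{(t+1)}_0=\lambda^{(t)}_{S_t}$,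 $\lambda^{(t+1)}_{-1}=\lambda^{(t)}_{S_t-1}$, $y^{(t+1)}_0=y^{(t)}_{S_t}$; $x^t=\sum_s\delta^{(t)}_sy^{(t)}_s/\sum_s\delta^{(t)}_s$. The output is $\bar x^N=\sum_{t=1}^N\omega_tx^t/\sum_{t=1}^N\omega_t$. One gradient-oracle evaluation of $(f,g)$ is made per phase, and each inner iteration uses fewer than three matrix-vector multiplications.
   Formalization: In both bounds the term sqrt(L(Λ_c)/ε)·‖x^0−x*‖ is replaced by its maximum with 1 (N_ε ≤ max{1, 10·term}; constant 50 in C_ε), since at least one phase is always needed while that term can tend to 0 even when x^0 is not ε-optimal. *)

theory Defs
  imports "HOL-Analysis.Analysis"
begin

definition normal_cone :: "'a::real_inner set \<Rightarrow> 'a \<Rightarrow> 'a set" where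
  "normal_cone X x = {v. \<forall>y\<in>X. v \<bullet> (y - x) \<le> 0}"

(* The effective domain U is explicit: u on U encodes the extended-valued function
   that is infinite outside U; U = UNIV is the case of a real-valued u on the whole space. *)
definition subdifferential :: "'a::real_inner set \<Rightarrow> ('a \<Rightarrow> real) \<Rightarrow> 'a \<Rightarrow> 'a set" where
  "subdifferential U u x = {v. \<forall>y\<in>U. u x + v \<bullet> (y - x) \<le> u y}"

definition pos_part :: "real ^ 'm \<Rightarrow> real ^ 'm" where
  "pos_part v = (\<chi> i. max (v $ i) 0)"

definition mat_norm :: "real ^ 'n ^ 'm \<Rightarrow> real" where
  "mat_norm A = onorm (\<lambda>h. A *v h)"

(* Orders on vectors are componentwise throughout. *)
definition optimal_solution ::
  "(real ^ 'n) set \<Rightarrow> (real ^ 'n \<Rightarrow> real) \<Rightarrow> (real ^ 'n \<Rightarrow> real ^ 'm) \<Rightarrow> real ^ 'n \<Rightarrow> bool" where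
  "optimal_solution X F g xs \<longleftrightarrow> is_arg_min F (\<lambda>x. x \<in> X \<and> g x \<le> 0) xs"

(* gf is the gradient of f and J the Jacobian of g, so row i (J x) is the gradient of g_i. *)
definition kkt_pair ::
  "(real ^ 'n) set \<Rightarrow> (real ^ 'n \<Rightarrow> real ^ 'n) \<Rightarrow> (real ^ 'n \<Rightarrow> real ^ 'm) \<Rightarrow>
   (real ^ 'n \<Rightarrow> real ^ 'n ^ 'm) \<Rightarrow> (real ^ 'n) set \<Rightarrow> (real ^ 'n \<Rightarrow> real) \<Rightarrow>
   real ^ 'n \<Rightarrow> real ^ 'm \<Rightarrow> bool" where
  "kkt_pair X gf g J U u xs ls \<longleftrightarrow>
     xs \<in> X \<and> 0 \<le> ls \<and> g xs \<le> 0 \<and> (\<forall>i. ls $ i * g xs $ i = 0) \<and>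
     (\<exists>u'\<in>subdifferential U u xs.
        - (gf xs + (\<Sum>i\<in>UNIV. ls $ i *\<^sub>R row i (J xs)) + u') \<in> normal_cone X xs)"

definition eps_optimal ::
  "(real ^ 'n \<Rightarrow> real) \<Rightarrow> (real ^ 'n \<Rightarrow> real ^ 'm) \<Rightarrow> real \<Rightarrow> real \<Rightarrow> real \<Rightarrow> real ^ 'n \<Rightarrow> bool" where
  "eps_optimal F g Fstar e1 e2 x \<longleftrightarrow> F x - Fstar \<le> e1 \<and> norm (pos_part (g x)) \<le> e2"

definition Lambda_set :: "real ^ 'm \<Rightarrow> real \<Rightarrow> (real ^ 'm) set" where
  "Lambda_set ls r = {0} \<union> {ls + l | l. 0 \<le> l \<and> norm l \<le> r}"

(* The extrapolated dual term of inner iteration s in phase t; nu t is the Jacobian used in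
   phase t.  The second index of lam is an integer because it starts at -1. *)
definition extrapolated_dual ::
  "(nat \<Rightarrow> real ^ 'n ^ 'm) \<Rightarrow> (nat \<Rightarrow> nat \<Rightarrow> real) \<Rightarrow> (nat \<Rightarrow> int \<Rightarrow> real ^ 'm) \<Rightarrow>
   nat \<Rightarrow> nat \<Rightarrow> real ^ 'n" where
  "extrapolated_dual nu \<rho> lam t s =
     (if s = 1
      then transpose (nu t) *v lam t 0
           + \<rho> t 1 *\<^sub>R (transpose (nu (t - 1)) *v (lam t 0 - lam t (-1)))
      else transpose (nu t) *v lam t (int s - 1)
           + \<rho> t s *\<^sub>R (transpose (nu t) *v (lam t (int s - 1) - lam t (int s - 2))))"

(* Every sequence generated by the ACGD-S method.  x is indexed from -1, xu t is the point
   at which phase t evaluates gf, g and J, and (y t s, lam t s) are the inner iterates.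
   The stepsizes do not depend on the number of phases, so the run is an infinite sequence
   of phases whose first N ones make up the N-phase method. *)
definition acgd_s ::
  "(real ^ 'n) set \<Rightarrow> (real ^ 'n \<Rightarrow> real ^ 'n) \<Rightarrow> (real ^ 'n \<Rightarrow> real ^ 'm) \<Rightarrow>
   (real ^ 'n \<Rightarrow> real ^ 'n ^ 'm) \<Rightarrow> (real ^ 'n \<Rightarrow> real) \<Rightarrow> real ^ 'n \<Rightarrow>
   (nat \<Rightarrow> real) \<Rightarrow> (nat \<Rightarrow> real) \<Rightarrow> (nat \<Rightarrow> real) \<Rightarrow> (nat \<Rightarrow> nat) \<Rightarrow>
   (nat \<Rightarrow> nat \<Rightarrow> real) \<Rightarrow> (nat \<Rightarrow> nat \<Rightarrow> real) \<Rightarrow> (nat \<Rightarrow> nat \<Rightarrow> real) \<Rightarrow> (nat \<Rightarrow> nat \<Rightarrow> real) \<Rightarrow>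
   (int \<Rightarrow> real ^ 'n) \<Rightarrow> (nat \<Rightarrow> real ^ 'n) \<Rightarrow> (nat \<Rightarrow> nat \<Rightarrow> real ^ 'n) \<Rightarrow>
   (nat \<Rightarrow> int \<Rightarrow> real ^ 'm) \<Rightarrow> bool" where
  "acgd_s X gf g J u x0 \<tau> \<theta> \<eta> S \<rho> \<beta> \<gamma> \<delta> x xu y lam \<longleftrightarrow>
     x0 \<in> X \<and> x (-1) = x0 \<and> x 0 = x0 \<and> xu 0 = x0 \<and> y 1 0 = x0 \<and>
     lam 1 (-1) = 0 \<and> lam 1 0 = 0 \<and>
     (\<forall>t\<ge>1.
        xu t = (\<tau> t *\<^sub>R xu (t - 1)
                + (x (int t - 1) + \<theta> t *\<^sub>R (x (int t - 1) - x (int t - 2)))) /\<^sub>R (1 + \<tau> t) \<and>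
        (\<forall>s\<in>{1..S t}.
           is_arg_min
             (\<lambda>z. (extrapolated_dual (\<lambda>k. J (xu k)) \<rho> lam t s + gf (xu t)) \<bullet> z + u z
                  + \<eta> t / 2 * (norm (z - x (int t - 1)))\<^sup>2
                  + \<beta> t s / 2 * (norm (z - y t (s - 1)))\<^sup>2)
             (\<lambda>z. z \<in> X) (y t s) \<and>
           is_arg_max
             (\<lambda>l. l \<bullet> (J (xu t) *v (y t s - xu t) + g (xu t))
                  - \<gamma> t s / 2 * (norm (l - lam t (int s - 1)))\<^sup>2)
             (\<lambda>l. 0 \<le> l) (lam t (int s))) \<and>
        lam (t + 1) 0 = lam t (int (S t)) \<and>
        lam (t + 1) (-1) = lam t (int (S t) - 1) \<and>
        y (t + 1) 0 = y t (S t) \<and>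
        x (int t) = (\<Sum>s=1..S t. \<delta> t s *\<^sub>R y t s) /\<^sub>R (\<Sum>s=1..S t. \<delta> t s))"

definition acgd_s_output :: "(nat \<Rightarrow> real) \<Rightarrow> (int \<Rightarrow> real ^ 'n) \<Rightarrow> nat \<Rightarrow> real ^ 'n" where
  "acgd_s_output \<omega> x N = (\<Sum>t=1..N. \<omega> t *\<^sub>R x (int t)) /\<^sub>R (\<Sum>t=1..N. \<omega> t)"

(* Each phase makes one evaluation of the first-order oracle of (f, g). *)
definition oracle_evaluations :: "nat \<Rightarrow> nat" where
  "oracle_evaluations N = (\<Sum>t=1..N. 1)"

(* An inner iteration uses fewer than three multiplications by a Jacobian or its transpose;
   it is charged three, an upper bound for the exact count. *)
definition matvec_multiplications :: "(nat \<Rightarrow> nat) \<Rightarrow> nat \<Rightarrow> nat" where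
  "matvec_multiplications S N = (\<Sum>t=1..N. \<Sum>s=1..S t. 3)"

end

theory Submission
  imports Defs
begin

text \<open>
  Everything follows from one estimate.  For a multiplier \<open>l\<close> whose Lagrangian \<open>f + l \<bullet> g\<close> has an
  \<open>L\<close>-Lipschitz gradient, the weighted average \<open>xbar\<close> of the outputs of \<open>N\<close> phases satisfies
  (\<open>lagrangian_gap\<close>)
  \<open>N (N + 1) / 2 * (F xbar + l \<bullet> g xbar - F xs) \<le> 3 L D\<^sup>2 / 2 + L (norm l)\<^sup>2 / (2 R\<^sup>2)\<close>.
  Since \<open>R = d / D\<close>, the right-hand side is at most \<open>2 L D\<^sup>2\<close> for every \<open>l\<close> in \<open>Lambda_set ls c\<close>,
  and \<open>N = \<lceil>2 sqrt (L / \<epsilon>) D\<rceil>\<close> phases push the gap below \<open>\<epsilon>\<close>.  With \<open>l = 0\<close> the gap is the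
  optimality gap.  With \<open>l = ls + c v\<close>, where \<open>v\<close> is the unit vector along the positive part of
  \<open>g xbar\<close>, it dominates \<open>c\<close> times the infeasibility, because \<open>xs\<close> minimizes
  \<open>F + ls \<bullet> g\<close> over \<open>X\<close> (\<open>kkt_pair_lagrangian_minimum\<close>).

  The estimate couples two telescoping sums.  The outer loop is Nesterov acceleration for the
  smooth function \<open>f + l \<bullet> g\<close>: replacing this function by its linearizations at the query
  points costs \<open>L\<close> times the squared movements of the phase outputs
  (\<open>accelerated_linearization\<close>).  The inner loop is a primal-dual method for the bilinear saddle
  point problem that the linearization in phase \<open>t\<close> defines.  The saddle gap
  after each of its steps is bounded by the decrease of a Lyapunov function
  (\<open>primal_dual_step\<close>), and its proximal terms centred at the previous phase
  output earn exactly the squared movement that the outer loop costs (\<open>phase_bound\<close>).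

  The Jacobian changes from phase to phase, yet the Lyapunov function does not: an inner
  iteration of phase \<open>t\<close> has weight \<open>t / S t\<close> in the final average, and weight times step size
  is the constant \<open>L\<close> on the primal and \<open>L / R\<^sup>2\<close> on the dual side.  The number \<open>S t\<close> of inner
  iterations is just large enough for these constants to control the Jacobian of the phase.
  It is at most \<open>Mbar R t / L + 1\<close>, and summing over \<open>t \<le> N\<close> gives the second complexity bound.
\<close>

section \<open>Smooth convex functions\<close>

lemma convex_above_tangent:
  fixes h :: "'a::real_normed_vector \<Rightarrow> real"
  assumes convex: "convex_on UNIV h" and deriv: "(h has_derivative h') (at a)"
  shows "h a + h' (b - a) \<le> h b"
proof -
  define \<phi> where "\<phi> = (\<lambda>s. h (a + s *\<^sub>R (b - a)))"
  have "convex_on UNIV \<phi>"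
  proof (rule convex_onI)
    fix t r s :: real
    assume t: "0 < t" "t < 1"
    have "a + ((1 - t) *\<^sub>R r + t *\<^sub>R s) *\<^sub>R (b - a)
        = (1 - t) *\<^sub>R (a + r *\<^sub>R (b - a)) + t *\<^sub>R (a + s *\<^sub>R (b - a))"
      by (simp add: algebra_simps)
    then show "\<phi> ((1 - t) *\<^sub>R r + t *\<^sub>R s) \<le> (1 - t) * \<phi> r + t * \<phi> s"
      unfolding \<phi>_def using convex_onD[OF convex, of t] t by simp
  qed simp
  moreover have "(\<phi> has_real_derivative h' (b - a)) (at 0 within UNIV)"
  proof -
    have "((\<lambda>s. a + s *\<^sub>R (b - a)) has_derivative (\<lambda>s. s *\<^sub>R (b - a))) (at 0)"
      by (auto intro!: derivative_eq_intros)
    moreover have "(h has_derivative h') (at (a + 0 *\<^sub>R (b - a)))"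
      using deriv by simp
    ultimately have "(\<phi> has_derivative (\<lambda>s. h' (s *\<^sub>R (b - a)))) (at 0)"
      unfolding \<phi>_def by (rule has_derivative_compose)
    moreover have "h' (s *\<^sub>R (b - a)) = h' (b - a) * s" for s
      using linear_scale[OF has_derivative_linear[OF deriv]] by simp
    ultimately show ?thesis
      by (simp add: has_field_derivative_def)
  qed
  ultimately have "h' (b - a) * (1 - 0) \<le> \<phi> 1 - \<phi> 0"
    by (intro convex_on_imp_above_tangent[where A = UNIV]) auto
  then show ?thesis
    by (simp add: \<phi>_def)
qed

lemma descent_inequality:
  fixes h :: "'a::real_inner \<Rightarrow> real"
  assumes deriv: "\<And>z. (h has_derivative (\<lambda>v. G z \<bullet> v)) (at z)"
    and lipschitz: "L-lipschitz_on UNIV G"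
  shows "h b \<le> h a + G a \<bullet> (b - a) + L / 2 * (norm (b - a))\<^sup>2"
proof -
  define v where "v = b - a"
  define \<phi> where
    "\<phi> = (\<lambda>s. h (a + s *\<^sub>R v) - s * (G a \<bullet> v) - L / 2 * s\<^sup>2 * (norm v)\<^sup>2)"
  define \<phi>' where
    "\<phi>' = (\<lambda>s. G (a + s *\<^sub>R v) \<bullet> v - G a \<bullet> v - L * s * (norm v)\<^sup>2)"
  have "(\<phi> has_real_derivative \<phi>' s) (at s)" for s
  proof -
    have "((\<lambda>s. a + s *\<^sub>R v) has_derivative (\<lambda>r. r *\<^sub>R v)) (at s)"
      by (auto intro!: derivative_eq_intros)
    then have "((\<lambda>s. h (a + s *\<^sub>R v)) has_derivative (\<lambda>r. G (a + s *\<^sub>R v) \<bullet> (r *\<^sub>R v))) (at s)"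
      using deriv by (rule has_derivative_compose)
    then have "((\<lambda>s. h (a + s *\<^sub>R v)) has_real_derivative G (a + s *\<^sub>R v) \<bullet> v) (at s)"
      by (simp add: has_field_derivative_def mult.commute[of _ "G (a + s *\<^sub>R v) \<bullet> v"])
    then show ?thesis
      unfolding \<phi>_def \<phi>'_def by (auto intro!: derivative_eq_intros)
  qed
  moreover have "\<phi>' s \<le> 0" if "0 \<le> s" for s
  proof -
    have "(G (a + s *\<^sub>R v) - G a) \<bullet> v \<le> norm (G (a + s *\<^sub>R v) - G a) * norm v"
      by (rule norm_cauchy_schwarz)
    also have "\<dots> \<le> (L * norm (s *\<^sub>R v)) * norm v"
      using lipschitz_onD[OF lipschitz, of "a + s *\<^sub>R v" a]
      by (intro mult_right_mono) (auto simp: dist_norm)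
    finally show ?thesis
      using that by (simp add: \<phi>'_def inner_diff_left power2_eq_square mult.assoc)
  qed
  ultimately have "\<exists>d. (\<phi> has_real_derivative d) (at s) \<and> d \<le> 0" if "0 \<le> s" for s
    using that by blast
  then have "\<phi> 1 \<le> \<phi> 0"
    by (intro DERIV_nonpos_imp_nonincreasing[of 0 1 \<phi>]) simp_all
  then show ?thesis
    by (simp add: \<phi>_def v_def)
qed

text \<open>
  The tangent at \<open>a\<close> and the quadratic upper model at \<open>b\<close> sandwich \<open>h\<close> at the point that
  minimizes their difference; this improves the tangent inequality by the squared distance of
  the two gradients.
\<close>

lemma cocoercive_tangent:
  fixes h :: "'a::real_inner \<Rightarrow> real"
  assumes convex: "convex_on UNIV h"
    and deriv: "\<And>z. (h has_derivative (\<lambda>v. G z \<bullet> v)) (at z)"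
    and lipschitz: "L-lipschitz_on UNIV G" and L: "0 < L"
  shows "h a + G a \<bullet> (b - a) + (norm (G b - G a))\<^sup>2 / (2 * L) \<le> h b"
proof -
  define w where "w = G b - G a"
  define p where "p = b - (1 / L) *\<^sub>R w"
  have "h a + G a \<bullet> (p - a) \<le> h b + G b \<bullet> (p - b) + L / 2 * (norm (p - b))\<^sup>2"
    using convex_above_tangent[OF convex deriv, of a p]
      descent_inequality[OF deriv lipschitz, of p b] by linarith
  moreover have "L / 2 * (norm (p - b))\<^sup>2 = (norm w)\<^sup>2 / (2 * L)"
    using L by (simp add: p_def power_mult_distrib power_divide power2_eq_square)
  moreover have "G a \<bullet> (p - a) = G a \<bullet> (b - a) - (G a \<bullet> w) / L"
    by (simp add: p_def inner_diff_right)
  moreover have "G b \<bullet> (p - b) = - (G b \<bullet> w) / L"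
    by (simp add: p_def)
  moreover have "(G b \<bullet> w) / L - (G a \<bullet> w) / L = 2 * ((norm w)\<^sup>2 / (2 * L))"
    using L by (simp add: w_def power2_norm_eq_inner inner_diff_left field_simps)
  ultimately show ?thesis
    unfolding w_def by linarith
qed

section \<open>Proximal steps\<close>

lemma norm_power2_convex_combination:
  fixes a y z :: "'a::real_inner"
  shows "(norm ((1 - s) *\<^sub>R y + s *\<^sub>R z - a))\<^sup>2
    = (1 - s) * (norm (y - a))\<^sup>2 + s * (norm (z - a))\<^sup>2 - s * (1 - s) * (norm (z - y))\<^sup>2"
  unfolding power2_norm_eq_inner
  by (simp add: inner_simps inner_commute[of a y] inner_commute[of a z] inner_commute[of z y])
    (simp add: algebra_simps)

lemma convex_on_norm_power2:
  fixes a :: "'a::real_inner"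
  assumes "convex X"
  shows "convex_on X (\<lambda>y. (norm (y - a))\<^sup>2)"
  by (rule convex_onI[OF _ assms]) (simp add: norm_power2_convex_combination)

text \<open>
  The objective grows quadratically away from its minimizer \<open>y\<close>: compare \<open>y\<close> with a point of
  the segment from \<open>y\<close> to \<open>z\<close> and let this point tend to \<open>y\<close>.
\<close>

lemma prox_inequality:
  fixes y :: "'a::real_inner"
  assumes convex: "convex_on X \<psi>" and X: "y \<in> X" "z \<in> X"
    and minimal: "\<And>p. p \<in> X \<Longrightarrow>
      \<psi> y + \<eta> / 2 * (norm (y - a))\<^sup>2 + \<beta> / 2 * (norm (y - b))\<^sup>2
        \<le> \<psi> p + \<eta> / 2 * (norm (p - a))\<^sup>2 + \<beta> / 2 * (norm (p - b))\<^sup>2"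
  shows "\<psi> y + \<eta> / 2 * (norm (y - a))\<^sup>2 + \<beta> / 2 * (norm (y - b))\<^sup>2
      + (\<eta> + \<beta>) / 2 * (norm (z - y))\<^sup>2
    \<le> \<psi> z + \<eta> / 2 * (norm (z - a))\<^sup>2 + \<beta> / 2 * (norm (z - b))\<^sup>2"
proof -
  define \<Psi> where
    "\<Psi> = (\<lambda>p. \<psi> p + \<eta> / 2 * (norm (p - a))\<^sup>2 + \<beta> / 2 * (norm (p - b))\<^sup>2)"
  define q where "q = (\<eta> + \<beta>) / 2 * (norm (z - y))\<^sup>2"
  have "r * q \<le> \<Psi> z - \<Psi> y" if r: "0 < r" "r < 1" for r
  proof -
    define s where "s = 1 - r"
    have s: "0 < s" "s < 1"
      using r by (auto simp: s_def)
    define p where "p = (1 - s) *\<^sub>R y + s *\<^sub>R z"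
    have "p \<in> X"
      unfolding p_def using convexD_alt[OF convex_on_imp_convex[OF convex]] X s by simp
    have "\<psi> p \<le> (1 - s) * \<psi> y + s * \<psi> z"
      unfolding p_def using convex_onD[OF convex, of s y z] X s by simp
    then have "\<Psi> p \<le> (1 - s) * \<Psi> y + s * \<Psi> z - s * ((1 - s) * q)"
      unfolding \<Psi>_def q_def norm_power2_convex_combination[of s y z, folded p_def]
      by (simp add: algebra_simps add_divide_distrib diff_divide_distrib)
    with minimal[OF \<open>p \<in> X\<close>] have "\<Psi> y \<le> (1 - s) * \<Psi> y + s * \<Psi> z - s * ((1 - s) * q)"
      unfolding \<Psi>_def by linarith
    then have "s * (r * q) \<le> s * (\<Psi> z - \<Psi> y)"
      by (simp add: s_def algebra_simps)
    then show ?thesis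
      using s by simp
  qed
  then have "q \<le> \<Psi> z - \<Psi> y"
    by (rule field_le_mult_one_interval)
  then show ?thesis
    by (simp add: \<Psi>_def q_def)
qed

section \<open>The outer loop: accelerated gradients\<close>

lemma weighted_young:
  fixes v w :: "'a::real_inner"
  assumes L: "0 < L" and n: "0 \<le> n" and D: "(norm v)\<^sup>2 / (2 * L) \<le> D"
  shows "n * (v \<bullet> w) - n * (n + 1) / 2 * D \<le> L * (norm w)\<^sup>2"
proof -
  have "0 \<le> (norm (n *\<^sub>R v - (2 * L) *\<^sub>R w))\<^sup>2"
    by simp
  also have "\<dots> = n\<^sup>2 * (norm v)\<^sup>2 - 4 * L * (n * (v \<bullet> w)) + 4 * L * (L * (norm w)\<^sup>2)"
    unfolding power2_norm_eq_inner
    by (simp add: inner_simps inner_commute[of w v]) (simp add: algebra_simps power2_eq_square)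
  finally have "n * (v \<bullet> w) \<le> n\<^sup>2 * ((norm v)\<^sup>2 / (4 * L)) + L * (norm w)\<^sup>2"
    using L by (simp add: field_simps)
  also have "n\<^sup>2 * ((norm v)\<^sup>2 / (4 * L)) \<le> (n * (n + 1)) * ((norm v)\<^sup>2 / (4 * L))"
    using L n by (intro mult_right_mono) (auto simp: power2_eq_square algebra_simps)
  also have "(n * (n + 1)) * ((norm v)\<^sup>2 / (4 * L)) \<le> n * (n + 1) / 2 * D"
    using mult_left_mono[OF D, of "n * (n + 1) / 2"] n by simp
  finally show ?thesis
    by simp
qed

text \<open>
  This is the acceleration estimate.  The values of \<open>h\<close> on the left are linearized at the final
  reference point \<open>z\<close>, those on the right at the points \<open>a t\<close> where the method queries
  the gradient.  The weighted Bregman distances \<open>t (t + 1) / 2 * D t\<close> from \<open>z\<close> to \<open>a t\<close>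
  telescope because \<open>a (t + 1)\<close> is an average of \<open>a t\<close> and an extrapolation of \<open>p t\<close>; the
  inner products left over by the extrapolation are absorbed, by cocoercivity, into the Bregman
  distances between consecutive \<open>a t\<close> at the price of the squared movements of \<open>p\<close>.
\<close>

lemma accelerated_linearization:
  fixes h :: "'a::real_inner \<Rightarrow> real" and p a :: "nat \<Rightarrow> 'a"
  assumes L: "0 < L"
    and cocoercive: "\<And>a b. h a + G a \<bullet> (b - a) + (norm (G b - G a))\<^sup>2 / (2 * L) \<le> h b"
    and start: "a 1 = p 0"
    and extrapolation: "\<And>t. 1 \<le> t \<Longrightarrow>
      ((real t + 1) * (real t + 2) / 2) *\<^sub>R a (t + 1)
        = (real t * (real t + 1) / 2) *\<^sub>R a t + (real t + 1) *\<^sub>R p t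
          + real t *\<^sub>R (p t - p (t - 1))"
    and N: "1 \<le> N"
  shows "(\<Sum>t=1..N. real t * (h z + G z \<bullet> (p t - z)))
    \<le> (\<Sum>t=1..N. real t * (h (a t) + G (a t) \<bullet> (p t - a t)))
      + L * (\<Sum>t=1..N. (norm (p t - p (t - 1)))\<^sup>2)"
proof -
  define e where
    "e t = real t * (h z + G z \<bullet> (p t - z) - h (a t) - G (a t) \<bullet> (p t - a t))" for t
  define m where "m t = (norm (p t - p (t - 1)))\<^sup>2" for t
  define bregman where "bregman b c = h b - h c - G c \<bullet> (b - c)" for b c
  have bregman_ge: "(norm (G b - G c))\<^sup>2 / (2 * L) \<le> bregman b c" for b c
    using cocoercive[of c b] by (simp add: bregman_def)
  have bound: "n * (v \<bullet> w) - n * (n + 1) / 2 * bregman b c \<le> L * (norm w)\<^sup>2"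
    if "v = G c - G b" "0 \<le> n" for n v w b c
    using weighted_young[OF L that(2), of v "bregman b c" w] bregman_ge[of b c] that(1)
    by (simp add: norm_minus_commute)
  have telescope: "(\<Sum>t=1..N. e t) \<le> real N * ((G z - G (a N)) \<bullet> (p N - p (N - 1)))
      - real N * (real N + 1) / 2 * bregman (a N) z + L * (\<Sum>t=1..N - 1. m t)"
    using N
  proof (induction N rule: nat_induct_at_least)
    case base
    show ?case
      using start by (simp add: e_def bregman_def inner_simps)
  next
    case (Suc n)
    define r where "r = real n"
    have rSuc: "real (Suc n) = r + 1"
      by (simp add: r_def)
    have split: "(\<Sum>t=1..n. m t) = (\<Sum>t=1..n - 1. m t) + m n"
      using sum.nat_ivl_Suc'[of 1 "n - 1" m] \<open>1 \<le> n\<close> by (simp add: add.commute)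
    \<comment> \<open>\<open>gap v = 0\<close> is the extrapolation rule tested against \<open>v\<close>.\<close>
    define gap where "gap v = (r + 1) * (r + 2) / 2 * (v \<bullet> a (Suc n))
        - r * (r + 1) / 2 * (v \<bullet> a n) - (r + 1) * (v \<bullet> p n) - r * (v \<bullet> p n - v \<bullet> p (n - 1))" for v
    have "gap v = 0" for v
    proof -
      have "gap v = v \<bullet> (((r + 1) * (r + 2) / 2) *\<^sub>R a (Suc n) - ((r * (r + 1) / 2) *\<^sub>R a n
        + (r + 1) *\<^sub>R p n + r *\<^sub>R (p n - p (n - 1))))"
        by (simp add: gap_def inner_simps)
      then show ?thesis
        using extrapolation[OF \<open>1 \<le> n\<close>] by (simp add: r_def)
    qed
    have "r * ((G (a (Suc n)) - G (a n)) \<bullet> (p n - p (n - 1)))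
        - r * (r + 1) / 2 * bregman (a n) (a (Suc n)) \<le> L * m n"
      unfolding m_def by (rule bound) (auto simp: r_def)
    moreover
    have "e (Suc n) + r * ((G z - G (a n)) \<bullet> (p n - p (n - 1)))
        - r * (r + 1) / 2 * bregman (a n) z
      = (r + 1) * ((G z - G (a (Suc n))) \<bullet> (p (Suc n) - p n))
        - (r + 1) * (r + 2) / 2 * bregman (a (Suc n)) z
        + (r * ((G (a (Suc n)) - G (a n)) \<bullet> (p n - p (n - 1)))
        - r * (r + 1) / 2 * bregman (a n) (a (Suc n)))
        + gap (G (a (Suc n))) - gap (G z)"
      unfolding e_def bregman_def rSuc inner_simps gap_def
      by (simp add: algebra_simps add_divide_distrib diff_divide_distrib)
    ultimately show ?case
      using Suc.IH split \<open>\<And>v. gap v = 0\<close> unfolding rSuc by (simp add: r_def[symmetric] algebra_simps)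
  qed
  have "real N * ((G z - G (a N)) \<bullet> (p N - p (N - 1)))
      - real N * (real N + 1) / 2 * bregman (a N) z \<le> L * m N"
    unfolding m_def by (rule bound) auto
  moreover have "(\<Sum>t=1..N. m t) = (\<Sum>t=1..N - 1. m t) + m N"
    using sum.nat_ivl_Suc'[of 1 "N - 1" m] N by (simp add: add.commute)
  ultimately have "(\<Sum>t=1..N. e t) \<le> L * (\<Sum>t=1..N. m t)"
    using telescope by (simp add: distrib_left)
  moreover have "(\<Sum>t=1..N. e t) = (\<Sum>t=1..N. real t * (h z + G z \<bullet> (p t - z)))
      - (\<Sum>t=1..N. real t * (h (a t) + G (a t) \<bullet> (p t - a t)))"
    by (simp add: e_def sum_subtractf[symmetric] algebra_simps)
  ultimately show ?thesis
    by (simp add: m_def)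
qed

section \<open>The inner loop: primal-dual steps\<close>

lemma norm_vector_matrix_mult_le:
  fixes A :: "real ^ 'n ^ 'm"
  shows "norm (l v* A) \<le> mat_norm A * norm l"
proof (cases "l v* A = 0")
  case True
  then show ?thesis
    by (simp add: mat_norm_def onorm_pos_le)
next
  case False
  have "norm (l v* A) * norm (l v* A) = l \<bullet> (A *v (l v* A))"
    unfolding dot_lmul_matrix[symmetric] by (simp add: power2_norm_eq_inner[symmetric] power2_eq_square)
  also have "\<dots> \<le> norm l * norm (A *v (l v* A))"
    by (rule norm_cauchy_schwarz)
  also have "\<dots> \<le> norm l * (mat_norm A * norm (l v* A))"
    unfolding mat_norm_def by (intro mult_left_mono onorm) auto
  finally have "norm (l v* A) * norm (l v* A) \<le> (mat_norm A * norm l) * norm (l v* A)"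
    by (simp only: ac_simps)
  then show ?thesis
    using False by (metis mult_right_le_imp_le zero_less_norm_iff)
qed

text \<open>
  The Lyapunov function of the primal-dual iteration.  Here \<open>y\<close>, \<open>l1\<close> and \<open>l0\<close> are the
  current primal iterate and the last two dual iterates, \<open>z\<close> and \<open>l\<close> the reference points,
  and \<open>m\<close> is the dual momentum, in primal space, by which the next primal step extrapolates.
\<close>

definition pd_potential ::
  "real \<Rightarrow> real \<Rightarrow> 'a::real_inner \<Rightarrow> 'b::real_inner \<Rightarrow> 'a \<Rightarrow> 'b \<Rightarrow> 'b \<Rightarrow> 'a \<Rightarrow> real" where
  "pd_potential L K z l y l1 l0 m = L / 2 * (norm (z - y))\<^sup>2 + K / 2 * (norm (l - l1))\<^sup>2
     + K / 2 * (norm (l1 - l0))\<^sup>2 - m \<bullet> (y - z)"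

lemma inner_le_young:
  fixes m v :: "'a::real_inner" and w :: "'b::real_normed_vector"
  assumes "0 < L" and "(norm m)\<^sup>2 \<le> L * K * (norm w)\<^sup>2"
  shows "m \<bullet> v \<le> L / 2 * (norm v)\<^sup>2 + K / 2 * (norm w)\<^sup>2"
proof -
  have "0 \<le> (norm (m - L *\<^sub>R v))\<^sup>2"
    by simp
  also have "\<dots> = (norm m)\<^sup>2 - 2 * L * (m \<bullet> v) + L * (L * (norm v)\<^sup>2)"
    unfolding power2_norm_eq_inner
    by (simp add: inner_simps inner_commute[of v m]) (simp add: algebra_simps)
  finally have "L * (2 * (m \<bullet> v)) \<le> L * (L * (norm v)\<^sup>2 + K * (norm w)\<^sup>2)"
    using assms(2) by (simp add: algebra_simps)
  then show ?thesis
    using assms(1) by simp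
qed

lemma pd_potential_nonneg:
  assumes "0 < L" "0 \<le> K" and "(norm m)\<^sup>2 \<le> L * K * (norm (l1 - l0))\<^sup>2"
  shows "0 \<le> pd_potential L K z l y l1 l0 m"
proof -
  have "m \<bullet> (y - z) \<le> L / 2 * (norm (y - z))\<^sup>2 + K / 2 * (norm (l1 - l0))\<^sup>2"
    by (rule inner_le_young) fact+
  moreover have "0 \<le> K / 2 * (norm (l - l1))\<^sup>2"
    using assms(2) by simp
  ultimately show ?thesis
    unfolding pd_potential_def by (simp add: norm_minus_commute)
qed

text \<open>
  One primal-dual step, weighted by \<open>w\<close>.  The step sizes \<open>\<beta>\<close> and \<open>\<gamma>\<close> vary with the norm of the
  matrix \<open>A\<close>, which changes between phases, but \<open>w * \<beta>\<close> and \<open>w * \<gamma>\<close> do not: this is why the same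
  potential serves all phases.  The momentum \<open>m\<close> of the previous step may come from another
  matrix; only its norm matters.
\<close>

lemma primal_dual_step:
  fixes A :: "real ^ 'n ^ 'm" and u :: "real ^ 'n \<Rightarrow> real"
    and y0 y1 z a q m v :: "real ^ 'n" and l l1 l0 l00 b :: "real ^ 'm"
  assumes convex: "convex_on X u" and z: "z \<in> X" and l: "0 \<le> l"
    and primal: "is_arg_min (\<lambda>z. (l0 v* A + (1 / w) *\<^sub>R m + v) \<bullet> z + u z
        + \<eta> / 2 * (norm (z - a))\<^sup>2 + \<beta> / 2 * (norm (z - y0))\<^sup>2) (\<lambda>z. z \<in> X) y1"
    and dual: "is_arg_max (\<lambda>l. l \<bullet> (A *v (y1 - q) + b) - \<gamma> / 2 * (norm (l - l0))\<^sup>2)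
        (\<lambda>l. 0 \<le> l) l1"
    and w: "0 < w" "w * \<beta> = L" "w * \<gamma> = K" and L: "0 < L"
    and m: "(norm m)\<^sup>2 \<le> L * K * (norm (l0 - l00))\<^sup>2"
  shows "w * ((v \<bullet> y1 + u y1 + l \<bullet> (b + A *v (y1 - q)) + \<eta> / 2 * (norm (y1 - a))\<^sup>2
        + \<eta> / 2 * (norm (y1 - z))\<^sup>2) - (v \<bullet> z + u z + l1 \<bullet> (b + A *v (z - q))))
    \<le> pd_potential L K z l y0 l0 l00 m
      - pd_potential L K z l y1 l1 l0 (w *\<^sub>R ((l1 - l0) v* A))
      + w * \<eta> / 2 * (norm (z - a))\<^sup>2"
proof -
  define h where "h = l0 v* A + (1 / w) *\<^sub>R m + v"
  have "convex_on X (\<lambda>z. h \<bullet> z + u z)"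
    using convex convex_on_imp_convex[OF convex]
    by (intro convex_on_add) (auto intro!: convex_onI simp: inner_simps)
  then have "h \<bullet> y1 + u y1 + \<eta> / 2 * (norm (y1 - a))\<^sup>2 + \<beta> / 2 * (norm (y1 - y0))\<^sup>2
      + (\<eta> + \<beta>) / 2 * (norm (z - y1))\<^sup>2
    \<le> h \<bullet> z + u z + \<eta> / 2 * (norm (z - a))\<^sup>2 + \<beta> / 2 * (norm (z - y0))\<^sup>2"
    using primal z unfolding is_arg_min_def h_def[symmetric] by (intro prox_inequality) force+
  from mult_left_mono[OF this, of w]
  have primal': "w * (h \<bullet> y1) + w * u y1 + w * \<eta> / 2 * (norm (y1 - a))\<^sup>2
      + (w * \<beta>) / 2 * (norm (y1 - y0))\<^sup>2 + w * \<eta> / 2 * (norm (y1 - z))\<^sup>2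
      + (w * \<beta>) / 2 * (norm (z - y1))\<^sup>2
    \<le> w * (h \<bullet> z) + w * u z + w * \<eta> / 2 * (norm (z - a))\<^sup>2
      + (w * \<beta>) / 2 * (norm (z - y0))\<^sup>2"
    using w(1) by (simp add: algebra_simps add_divide_distrib norm_minus_commute)
  have nonneg: "convex {l :: real ^ 'm. 0 \<le> l}"
    by (rule convexI) (auto simp: less_eq_vec_def)
  define d where "d = A *v (y1 - q) + b"
  have "convex_on {l. 0 \<le> l} (\<lambda>l. - (l \<bullet> d))"
    by (rule convex_onI[OF _ nonneg]) (simp add: inner_simps)
  then have "- (l1 \<bullet> d) + 0 / 2 * (norm (l1 - 0))\<^sup>2 + \<gamma> / 2 * (norm (l1 - l0))\<^sup>2
      + (0 + \<gamma>) / 2 * (norm (l - l1))\<^sup>2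
    \<le> - (l \<bullet> d) + 0 / 2 * (norm (l - 0))\<^sup>2 + \<gamma> / 2 * (norm (l - l0))\<^sup>2"
    using dual l unfolding is_arg_max_def d_def[symmetric] by (intro prox_inequality) force+
  from mult_left_mono[OF this, of w]
  have dual': "- (w * (l1 \<bullet> d)) + (w * \<gamma>) / 2 * (norm (l1 - l0))\<^sup>2
      + (w * \<gamma>) / 2 * (norm (l - l1))\<^sup>2
    \<le> - (w * (l \<bullet> d)) + (w * \<gamma>) / 2 * (norm (l - l0))\<^sup>2"
    using w(1) by (simp add: algebra_simps)
  have young: "m \<bullet> (y0 - y1) \<le> L / 2 * (norm (y1 - y0))\<^sup>2 + K / 2 * (norm (l0 - l00))\<^sup>2"
    using inner_le_young[OF L m, of "y0 - y1"] by (simp add: norm_minus_commute)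
  have h_inner: "w * (h \<bullet> p) = w * (l0 \<bullet> (A *v p)) + m \<bullet> p + w * (v \<bullet> p)" for p
    using w(1) by (simp add: h_def inner_simps dot_lmul_matrix algebra_simps)
  have momentum: "(w *\<^sub>R ((l1 - l0) v* A)) \<bullet> (y1 - z)
      = w * (l1 \<bullet> (A *v y1)) - w * (l1 \<bullet> (A *v z)) - w * (l0 \<bullet> (A *v y1)) + w * (l0 \<bullet> (A *v z))"
    by (simp add: dot_lmul_matrix inner_simps matrix_vector_mult_diff_distrib algebra_simps)
  have d_inner: "w * (k \<bullet> d) = w * (k \<bullet> (A *v y1)) - w * (k \<bullet> (A *v q)) + w * (k \<bullet> b)" for k
    by (simp add: d_def inner_simps matrix_vector_mult_diff_distrib algebra_simps)
  show ?thesis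
    using primal' dual' young
    unfolding pd_potential_def momentum w h_inner d_inner
    by (simp add: inner_simps matrix_vector_mult_diff_distrib algebra_simps)
qed

section \<open>The Lagrangian\<close>

lemma sum_scaleR_row_eq:
  fixes A :: "real ^ 'n ^ 'm"
  shows "(\<Sum>i\<in>UNIV. l $ i *\<^sub>R row i A) = l v* A"
  by (simp add: vec_eq_iff vector_matrix_mult_def row_def mult.commute)

lemma inner_mono_nonneg:
  fixes l v w :: "real ^ 'm"
  assumes "0 \<le> l" "v \<le> w"
  shows "l \<bullet> v \<le> l \<bullet> w"
  using assms unfolding inner_vec_def less_eq_vec_def
  by (intro sum_mono) (simp add: mult_left_mono)

lemma convex_on_lagrangian:
  fixes f :: "'a::real_vector \<Rightarrow> real" and g :: "'a \<Rightarrow> real ^ 'm"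
  assumes f: "convex_on UNIV f" and g: "\<And>i. convex_on UNIV (\<lambda>z. g z $ i)" and l: "0 \<le> l"
  shows "convex_on UNIV (\<lambda>z. f z + l \<bullet> g z)"
proof (rule convex_on_add[OF f], rule convex_onI)
  fix t :: real and a b :: 'a
  assume t: "0 < t" "t < 1"
  have "g ((1 - t) *\<^sub>R a + t *\<^sub>R b) \<le> (1 - t) *\<^sub>R g a + t *\<^sub>R g b"
    unfolding less_eq_vec_def using convex_onD[OF g, of t] t by simp
  from inner_mono_nonneg[OF l this]
  show "l \<bullet> g ((1 - t) *\<^sub>R a + t *\<^sub>R b) \<le> (1 - t) * (l \<bullet> g a) + t * (l \<bullet> g b)"
    by (simp add: inner_simps)
qed simp

lemma has_derivative_lagrangian:
  fixes f :: "real ^ 'n \<Rightarrow> real" and g :: "real ^ 'n \<Rightarrow> real ^ 'm"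
  assumes f: "GDERIV f z :> gf" and g: "(g has_derivative (\<lambda>h. J *v h)) (at z)"
  shows "((\<lambda>z. f z + l \<bullet> g z) has_derivative (\<lambda>v. (gf + l v* J) \<bullet> v)) (at z)"
proof -
  have "(f has_derivative (\<lambda>h. h \<bullet> gf)) (at z)"
    using f by (simp add: gderiv_def)
  then have "((\<lambda>z. f z + l \<bullet> g z) has_derivative (\<lambda>h. h \<bullet> gf + l \<bullet> (J *v h))) (at z)"
    using g by (intro has_derivative_add has_derivative_inner_right)
  then show ?thesis
    by (simp add: inner_add_left dot_lmul_matrix inner_commute[of gf])
qed

text \<open>
  The KKT conditions say that the linearization of the Lagrangian at the multiplier has
  nonnegative slope in every direction into \<open>X\<close>; complementary slackness removes the
  multiplier term at the solution.
\<close>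

lemma kkt_pair_lagrangian_minimum:
  fixes f u :: "real ^ 'n \<Rightarrow> real" and g :: "real ^ 'n \<Rightarrow> real ^ 'm"
  assumes f: "convex_on UNIV f" "\<And>z. GDERIV f z :> gf z"
    and g: "\<And>i. convex_on UNIV (\<lambda>z. g z $ i)" "\<And>z. (g has_derivative (\<lambda>h. J z *v h)) (at z)"
    and kkt: "kkt_pair X gf g J U u xs ls" and z: "z \<in> X" "z \<in> U"
  shows "f xs + u xs \<le> f z + u z + ls \<bullet> g z"
proof -
  from kkt obtain u' where ls: "0 \<le> ls" and slack: "\<forall>i. ls $ i * g xs $ i = 0"
    and u': "u' \<in> subdifferential U u xs"
    and cone: "- (gf xs + ls v* J xs + u') \<in> normal_cone X xs"
    unfolding kkt_pair_def sum_scaleR_row_eq by blast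
  have "ls \<bullet> g xs = 0"
    using slack unfolding inner_vec_def inner_real_def by (intro sum.neutral) simp
  moreover have "f xs + ls \<bullet> g xs + (gf xs + ls v* J xs) \<bullet> (z - xs) \<le> f z + ls \<bullet> g z"
    by (rule convex_above_tangent[OF convex_on_lagrangian has_derivative_lagrangian]) fact+
  moreover have "u xs + u' \<bullet> (z - xs) \<le> u z"
    using u' z(2) by (simp add: subdifferential_def)
  moreover have "0 \<le> (gf xs + ls v* J xs) \<bullet> (z - xs) + u' \<bullet> (z - xs)"
    using cone z(1) by (force simp: normal_cone_def inner_simps)
  ultimately show ?thesis
    by linarith
qed

lemma inner_pos_part:
  fixes v :: "real ^ 'm"
  shows "pos_part v \<bullet> v = (norm (pos_part v))\<^sup>2"
  unfolding power2_norm_eq_inner inner_vec_def pos_part_def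
  by (intro sum.cong) (auto simp: max_def)

section \<open>Runs of the sliding method\<close>

text \<open>
  The stepsizes appear in the closed form in which the analysis uses them: \<open>t / S t\<close> is the weight
  of an inner iteration, so that \<open>\<rho>_first\<close>, \<open>\<beta>\<close> and \<open>\<gamma>\<close> show how each parameter depends on it.
\<close>

locale acgd_s_run =
  fixes X :: "(real ^ 'n) set" and f u :: "real ^ 'n \<Rightarrow> real"
    and g :: "real ^ 'n \<Rightarrow> real ^ 'm" and gf :: "real ^ 'n \<Rightarrow> real ^ 'n"
    and J :: "real ^ 'n \<Rightarrow> real ^ 'n ^ 'm" and xs x0 :: "real ^ 'n"
    and L R :: real and \<tau> \<theta> \<eta> :: "nat \<Rightarrow> real" and S :: "nat \<Rightarrow> nat"
    and \<rho> \<beta> \<gamma> \<delta> :: "nat \<Rightarrow> nat \<Rightarrow> real"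
    and x :: "int \<Rightarrow> real ^ 'n" and xu :: "nat \<Rightarrow> real ^ 'n"
    and y :: "nat \<Rightarrow> nat \<Rightarrow> real ^ 'n" and lam :: "nat \<Rightarrow> int \<Rightarrow> real ^ 'm"
  assumes u: "convex_on X u"
    and f: "convex_on UNIV f" "\<And>z. GDERIV f z :> gf z"
    and g: "\<And>i. convex_on UNIV (\<lambda>z. g z $ i)" "\<And>z. (g has_derivative (\<lambda>h. J z *v h)) (at z)"
    and feasible: "xs \<in> X" "g xs \<le> 0"
    and positive: "0 < L" "0 < R"
    and \<tau>: "\<And>t. 1 \<le> t \<Longrightarrow> \<tau> t = (real t - 1) / 2"
    and \<theta>: "\<And>t. 1 \<le> t \<Longrightarrow> \<theta> (t + 1) = real t / (real t + 1)"
    and \<eta>: "\<And>t. 1 \<le> t \<Longrightarrow> \<eta> t = 2 * L / real t"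
    and \<rho>_first: "\<And>t. 1 \<le> t \<Longrightarrow> \<rho> (t + 1) 1 = (real t / S t) / (real (t + 1) / S (t + 1))"
    and \<rho>: "\<And>t s. 1 \<le> t \<Longrightarrow> 2 \<le> s \<Longrightarrow> \<rho> t s = 1"
    and \<beta>: "\<And>t s. 1 \<le> t \<Longrightarrow> 1 \<le> s \<Longrightarrow> \<beta> t s = L / (real t / S t)"
    and \<gamma>: "\<And>t s. 1 \<le> t \<Longrightarrow> 1 \<le> s \<Longrightarrow> \<gamma> t s = L / R\<^sup>2 / (real t / S t)"
    and \<delta>: "\<And>t s. 1 \<le> t \<Longrightarrow> 1 \<le> s \<Longrightarrow> \<delta> t s = 1"
    and run: "acgd_s X gf g J u x0 \<tau> \<theta> \<eta> S \<rho> \<beta> \<gamma> \<delta> x xu y lam"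
    and S_pos: "\<And>t. 1 \<le> t \<Longrightarrow> 1 \<le> S t"
    and mat_norm_le: "\<And>t. 1 \<le> t \<Longrightarrow> mat_norm (J (xu t)) \<le> S t * L / (R * real t)"
begin

text \<open>
  The weight of a single inner iteration in the final average: phase \<open>t\<close> has weight \<open>t\<close>, shared
  equally by its iterations.
\<close>

definition weight :: "nat \<Rightarrow> real" where
  "weight t = real t / S t"

text \<open>
  The vector by which step \<open>s + 1\<close> of phase \<open>t\<close> extrapolates, scaled by the weight.  At the
  start of a phase the dual increment stems from the phase before, and so do the Jacobian and the
  weight.
\<close>

definition momentum :: "nat \<Rightarrow> nat \<Rightarrow> real ^ 'n" where
  "momentum t s = (if s = 0
     then weight (t - 1) *\<^sub>R ((lam t 0 - lam t (-1)) v* J (xu (t - 1)))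
     else weight t *\<^sub>R ((lam t (int s) - lam t (int s - 1)) v* J (xu t)))"

definition potential :: "real ^ 'm \<Rightarrow> nat \<Rightarrow> nat \<Rightarrow> real" where
  "potential l t s =
     pd_potential L (L / R\<^sup>2) xs l (y t s) (lam t (int s)) (lam t (int s - 1)) (momentum t s)"

definition linearized :: "real ^ 'm \<Rightarrow> nat \<Rightarrow> real ^ 'n \<Rightarrow> real" where
  "linearized l t z =
     f (xu t) + gf (xu t) \<bullet> (z - xu t) + l \<bullet> (g (xu t) + J (xu t) *v (z - xu t))"

lemma weight_pos: "1 \<le> t \<Longrightarrow> 0 < weight t"
  using S_pos[of t] by (simp add: weight_def)

lemma initial:
  shows "x0 \<in> X" "x (-1) = x0" "x 0 = x0" "y 1 0 = x0" "lam 1 (-1) = 0" "lam 1 0 = 0"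
  using run unfolding acgd_s_def by blast+

lemma query_point:
  assumes "1 \<le> t"
  shows "xu t = (\<tau> t *\<^sub>R xu (t - 1)
    + (x (int t - 1) + \<theta> t *\<^sub>R (x (int t - 1) - x (int t - 2)))) /\<^sub>R (1 + \<tau> t)"
  using run assms unfolding acgd_s_def by blast

lemma primal_step:
  assumes "1 \<le> t" "1 \<le> s" "s \<le> S t"
  shows "is_arg_min
    (\<lambda>z. (extrapolated_dual (\<lambda>k. J (xu k)) \<rho> lam t s + gf (xu t)) \<bullet> z + u z
      + \<eta> t / 2 * (norm (z - x (int t - 1)))\<^sup>2 + \<beta> t s / 2 * (norm (z - y t (s - 1)))\<^sup>2)
    (\<lambda>z. z \<in> X) (y t s)"
proof -
  have "s \<in> {1..S t}"
    using assms by simp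
  with run assms(1) show ?thesis
    unfolding acgd_s_def by blast
qed

lemma dual_step:
  assumes "1 \<le> t" "1 \<le> s" "s \<le> S t"
  shows "is_arg_max
    (\<lambda>l. l \<bullet> (J (xu t) *v (y t s - xu t) + g (xu t))
      - \<gamma> t s / 2 * (norm (l - lam t (int s - 1)))\<^sup>2)
    (\<lambda>l. 0 \<le> l) (lam t (int s))"
proof -
  have "s \<in> {1..S t}"
    using assms by simp
  with run assms(1) show ?thesis
    unfolding acgd_s_def by blast
qed

lemma next_phase:
  assumes "1 \<le> t"
  shows "lam (t + 1) 0 = lam t (int (S t))" "lam (t + 1) (-1) = lam t (int (S t) - 1)"
    "y (t + 1) 0 = y t (S t)"
  using run assms unfolding acgd_s_def by blast+

lemma inner_iterate_mem: "1 \<le> t \<Longrightarrow> 1 \<le> s \<Longrightarrow> s \<le> S t \<Longrightarrow> y t s \<in> X"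
  using primal_step[of t s] by (simp add: is_arg_min_def)

lemma inner_multiplier_nonneg: "1 \<le> t \<Longrightarrow> 1 \<le> s \<Longrightarrow> s \<le> S t \<Longrightarrow> 0 \<le> lam t (int s)"
  using dual_step[of t s] by (simp add: is_arg_max_def)

lemma phase_average:
  assumes "1 \<le> t"
  shows "x (int t) = (\<Sum>s=1..S t. (1 / S t) *\<^sub>R y t s)"
proof -
  have "x (int t) = (\<Sum>s=1..S t. \<delta> t s *\<^sub>R y t s) /\<^sub>R (\<Sum>s=1..S t. \<delta> t s)"
    using run assms unfolding acgd_s_def by blast
  also have "\<dots> = (\<Sum>s=1..S t. y t s) /\<^sub>R real (S t)"
    using \<delta>[OF assms] by simp
  finally show ?thesis
    by (simp add: scaleR_sum_right inverse_eq_divide)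
qed

lemma phase_output_mem: "x (int t) \<in> X"
proof (cases "t = 0")
  case True
  then show ?thesis
    by (simp add: initial)
next
  case False
  then have t: "1 \<le> t"
    by simp
  show ?thesis
    unfolding phase_average[OF t] using S_pos[OF t] inner_iterate_mem[OF t]
    by (intro convex_sum convex_on_imp_convex[OF u]) auto
qed

lemma output_mem:
  assumes "1 \<le> N"
  shows "acgd_s_output real x N \<in> X"
proof -
  have pos: "0 < (\<Sum>t=1..N. real t)"
    using assms by (intro sum_pos) auto
  have "acgd_s_output real x N = (\<Sum>t=1..N. (real t / (\<Sum>t=1..N. real t)) *\<^sub>R x (int t))"
    by (simp add: acgd_s_output_def scaleR_sum_right divide_inverse mult.commute)
  also have "\<dots> \<in> X"
    using pos phase_output_mem
    by (intro convex_sum convex_on_imp_convex[OF u]) (auto simp: sum_divide_distrib[symmetric])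
  finally show ?thesis .
qed

text \<open>
  This is where the choice of \<open>S t\<close> enters: the weight offsets the norm of the Jacobian, so that
  the momentum is controlled by the dual increment uniformly in the phase.
\<close>

lemma norm_weighted_jacobian_le:
  assumes "1 \<le> t"
  shows "(norm (weight t *\<^sub>R (v v* J (xu t))))\<^sup>2 \<le> L * (L / R\<^sup>2) * (norm v)\<^sup>2"
proof -
  have "norm (weight t *\<^sub>R (v v* J (xu t))) \<le> weight t * (mat_norm (J (xu t)) * norm v)"
    using weight_pos[OF assms] norm_vector_matrix_mult_le[of v "J (xu t)"] by simp
  also have "\<dots> \<le> weight t * (S t * L / (R * real t) * norm v)"
    using weight_pos[OF assms] mat_norm_le[OF assms]
    by (intro mult_left_mono mult_right_mono) auto
  also have "\<dots> = L / R * norm v"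
    using assms S_pos[OF assms] by (simp add: weight_def)
  finally have "(norm (weight t *\<^sub>R (v v* J (xu t))))\<^sup>2 \<le> (L / R * norm v)\<^sup>2"
    by (rule power_mono) simp
  also have "\<dots> = L * (L / R\<^sup>2) * (norm v)\<^sup>2"
    by (simp add: power2_eq_square)
  finally show ?thesis .
qed

lemma norm_momentum_le:
  assumes "1 \<le> t"
  shows "(norm (momentum t s))\<^sup>2
    \<le> L * (L / R\<^sup>2) * (norm (lam t (int s) - lam t (int s - 1)))\<^sup>2"
proof (cases "s = 0")
  case False
  then show ?thesis
    using norm_weighted_jacobian_le[OF assms] by (simp add: momentum_def)
next
  case True
  show ?thesis
  proof (cases "t = 1")
    case True
    then show ?thesis
      using \<open>s = 0\<close> initial by (simp add: momentum_def)
  next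
    case False
    then show ?thesis
      using \<open>s = 0\<close> assms norm_weighted_jacobian_le[of "t - 1"] by (simp add: momentum_def)
  qed
qed

lemma potential_nonneg: "1 \<le> t \<Longrightarrow> 0 \<le> potential l t s"
  unfolding potential_def using positive norm_momentum_le by (intro pd_potential_nonneg) auto

lemma potential_next_phase:
  assumes "1 \<le> t"
  shows "potential l (t + 1) 0 = potential l t (S t)"
  using next_phase[OF assms] S_pos[OF assms]
  by (simp add: potential_def momentum_def)

text \<open>
  The factor \<open>\<rho>\<close> at the start of a phase is exactly the ratio of weights that turns the previous
  phase's momentum into the current one's.
\<close>

lemma extrapolated_dual_eq:
  assumes t: "1 \<le> t" and s: "1 \<le> s"
  shows "extrapolated_dual (\<lambda>k. J (xu k)) \<rho> lam t s
    = lam t (int s - 1) v* J (xu t) + (1 / weight t) *\<^sub>R momentum t (s - 1)"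
proof (cases "s = 1")
  case False
  then have "momentum t (s - 1)
      = weight t *\<^sub>R ((lam t (int s - 1) - lam t (int s - 2)) v* J (xu t))"
    using s by (simp add: momentum_def of_nat_diff)
  then show ?thesis
    using False s \<rho>[OF t, of s] weight_pos[OF t] by (simp add: extrapolated_dual_def)
next
  case s1: True
  show ?thesis
  proof (cases "t = 1")
    case True
    then show ?thesis
      using s1 initial by (simp add: extrapolated_dual_def momentum_def)
  next
    case False
    then have "\<rho> t 1 = weight (t - 1) / weight t"
      using t \<rho>_first[of "t - 1"] by (simp add: weight_def)
    then show ?thesis
      using s1 by (simp add: extrapolated_dual_def momentum_def)
  qed
qed

lemma linearized_le_lagrangian:
  assumes "0 \<le> l"
  shows "linearized l t z \<le> f z + l \<bullet> g z"
proof -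
  have "f (xu t) + l \<bullet> g (xu t) + (gf (xu t) + l v* J (xu t)) \<bullet> (z - xu t) \<le> f z + l \<bullet> g z"
    by (rule convex_above_tangent[OF convex_on_lagrangian has_derivative_lagrangian])
      (fact f g assms)+
  then show ?thesis
    by (simp add: linearized_def inner_add_left inner_add_right dot_lmul_matrix)
qed

lemma inner_iteration_bound:
  assumes t: "1 \<le> t" and s: "1 \<le> s" "s \<le> S t" and l: "0 \<le> l"
  shows "weight t * (linearized l t (y t s) + u (y t s)
      + \<eta> t / 2 * (norm (y t s - x (int t - 1)))\<^sup>2 + \<eta> t / 2 * (norm (y t s - xs))\<^sup>2
      - (f xs + u xs))
    \<le> potential l t (s - 1) - potential l t s
      + weight t * \<eta> t / 2 * (norm (xs - x (int t - 1)))\<^sup>2"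
proof -
  define k where "k = lam t (int s)"
  have "0 \<le> k"
    unfolding k_def by (rule inner_multiplier_nonneg[OF t s])
  have "linearized k t xs \<le> f xs + k \<bullet> g xs"
    by (rule linearized_le_lagrangian) fact
  also have "k \<bullet> g xs \<le> 0"
    using inner_mono_nonneg[OF \<open>0 \<le> k\<close> feasible(2)] by simp
  finally have solution: "linearized k t xs \<le> f xs"
    by simp
  have w: "weight t * \<beta> t s = L" "weight t * \<gamma> t s = L / R\<^sup>2"
    using weight_pos[OF t] unfolding \<beta>[OF t s(1)] \<gamma>[OF t s(1)] weight_def[symmetric]
    by simp_all
  have m: "momentum t s = weight t *\<^sub>R ((k - lam t (int s - 1)) v* J (xu t))"
    using s by (simp add: momentum_def k_def)
  have "weight t * ((gf (xu t) \<bullet> y t s + u (y t s) + l \<bullet> (g (xu t) + J (xu t) *v (y t s - xu t))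
        + \<eta> t / 2 * (norm (y t s - x (int t - 1)))\<^sup>2 + \<eta> t / 2 * (norm (y t s - xs))\<^sup>2)
        - (gf (xu t) \<bullet> xs + u xs + k \<bullet> (g (xu t) + J (xu t) *v (xs - xu t))))
      \<le> pd_potential L (L / R\<^sup>2) xs l (y t (s - 1)) (lam t (int s - 1)) (lam t (int s - 2))
          (momentum t (s - 1))
        - pd_potential L (L / R\<^sup>2) xs l (y t s) k (lam t (int s - 1))
          (weight t *\<^sub>R ((k - lam t (int s - 1)) v* J (xu t)))
        + weight t * \<eta> t / 2 * (norm (xs - x (int t - 1)))\<^sup>2"
  proof (rule primal_dual_step[where \<beta> = "\<beta> t s" and \<gamma> = "\<gamma> t s", OF u feasible(1) l])
    show "(norm (momentum t (s - 1)))\<^sup>2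
        \<le> L * (L / R\<^sup>2) * (norm (lam t (int s - 1) - lam t (int s - 2)))\<^sup>2"
      using norm_momentum_le[OF t, of "s - 1"] s by (simp add: of_nat_diff)
  qed (use primal_step[OF t s] dual_step[OF t s] weight_pos[OF t] w positive in
      \<open>simp_all add: extrapolated_dual_eq[OF t s(1)] k_def\<close>)
  also have "\<dots> = potential l t (s - 1) - potential l t s
      + weight t * \<eta> t / 2 * (norm (xs - x (int t - 1)))\<^sup>2"
    using s by (simp add: potential_def m k_def of_nat_diff)
  finally show ?thesis
    using mult_left_mono[OF solution, of "weight t"] weight_pos[OF t]
    by (simp add: linearized_def inner_diff_right algebra_simps)
qed

text \<open>
  Jensen's inequality passes from the inner iterates to their average.  The proximity terms take
  part in it, since they are what pays for the movement of the phase outputs in the outer loop.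
\<close>

lemma phase_bound:
  assumes t: "1 \<le> t" and l: "0 \<le> l"
  shows "real t * (linearized l t (x (int t)) + u (x (int t)) - (f xs + u xs))
      + L * (norm (x (int t) - x (int t - 1)))\<^sup>2
    \<le> potential l t 0 - potential l (t + 1) 0
      + L * (norm (xs - x (int t - 1)))\<^sup>2 - L * (norm (xs - x (int t)))\<^sup>2"
proof -
  define n where "n = real (S t)"
  have n: "0 < n"
    using S_pos[OF t] by (simp add: n_def)
  have wn: "weight t * n = real t"
    using n by (simp add: weight_def n_def)
  have w\<eta>: "real t * \<eta> t / 2 = L"
    using \<eta>[OF t] t by simp
  define Q where "Q z = linearized l t z + u z + \<eta> t / 2 * (norm (z - x (int t - 1)))\<^sup>2
      + \<eta> t / 2 * (norm (z - xs))\<^sup>2" for z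
  have X: "convex X"
    by (rule convex_on_imp_convex[OF u])
  have \<eta>_nonneg: "0 \<le> \<eta> t / 2"
    using \<eta>[OF t] positive by simp
  have "convex_on X (linearized l t)"
    by (rule convex_onI[OF _ X])
      (simp add: linearized_def inner_simps matrix_vector_mult_diff_distrib
        matrix_vector_right_distrib matrix_vector_mult_scaleR algebra_simps)
  then have "convex_on X Q"
    unfolding Q_def
    by (intro convex_on_add convex_on_cmul convex_on_norm_power2 u X \<eta>_nonneg)
  then have "Q (x (int t)) \<le> (\<Sum>s=1..S t. (1 / S t) * Q (y t s))"
    unfolding phase_average[OF t] using S_pos[OF t] inner_iterate_mem[OF t]
    by (intro convex_on_sum) auto
  then have "real t * Q (x (int t)) \<le> real t * (\<Sum>s=1..S t. (1 / S t) * Q (y t s))"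
    by (rule mult_left_mono) simp
  also have "\<dots> = (\<Sum>s=1..S t. weight t * Q (y t s))"
    by (simp add: sum_distrib_left weight_def)
  also have "\<dots> \<le> (\<Sum>s=1..S t. potential l t (s - 1) - potential l t s
      + weight t * \<eta> t / 2 * (norm (xs - x (int t - 1)))\<^sup>2 + weight t * (f xs + u xs))"
  proof (rule sum_mono)
    fix s assume "s \<in> {1..S t}"
    then show "weight t * Q (y t s) \<le> potential l t (s - 1) - potential l t s
        + weight t * \<eta> t / 2 * (norm (xs - x (int t - 1)))\<^sup>2 + weight t * (f xs + u xs)"
      using inner_iteration_bound[OF t _ _ l, of s] unfolding Q_def by (simp add: right_diff_distrib)
  qed
  also have "\<dots> = (\<Sum>s=1..S t. potential l t (s - 1) - potential l t s)
      + weight t * n * (\<eta> t / 2 * (norm (xs - x (int t - 1)))\<^sup>2 + (f xs + u xs))"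
    unfolding sum.distrib n_def by (simp add: algebra_simps)
  also have "(\<Sum>s=1..S t. potential l t (s - 1) - potential l t s)
      = potential l t 0 - potential l (t + 1) 0"
    using sum_telescope''[of 0 "S t" "\<lambda>s. - potential l t s"] potential_next_phase[OF t]
    by (simp add: atLeastSucAtMost_greaterThanAtMost[symmetric])
  finally have "real t * Q (x (int t)) \<le> potential l t 0 - potential l (t + 1) 0
      + real t * \<eta> t / 2 * (norm (xs - x (int t - 1)))\<^sup>2 + real t * (f xs + u xs)"
    unfolding wn by (simp add: algebra_simps)
  moreover have "real t * Q (x (int t)) = real t * (linearized l t (x (int t)) + u (x (int t)))
      + real t * \<eta> t / 2 * (norm (x (int t) - x (int t - 1)))\<^sup>2
      + real t * \<eta> t / 2 * (norm (xs - x (int t)))\<^sup>2"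
    by (simp add: Q_def norm_minus_commute algebra_simps)
  ultimately show ?thesis
    unfolding w\<eta> by (simp add: algebra_simps)
qed

lemma phases_bound:
  assumes l: "0 \<le> l"
  shows "(\<Sum>t=1..N. real t * (linearized l t (x (int t)) + u (x (int t)) - (f xs + u xs)))
      + L * (\<Sum>t=1..N. (norm (x (int t) - x (int t - 1)))\<^sup>2)
    \<le> potential l 1 0 - potential l (N + 1) 0
      + L * (norm (xs - x0))\<^sup>2 - L * (norm (xs - x (int N)))\<^sup>2"
proof (induction N)
  case 0
  then show ?case
    by (simp add: initial)
next
  case (Suc N)
  have "int (Suc N) - 1 = int N"
    by simp
  then show ?case
    using Suc.IH phase_bound[of "Suc N", OF _ l] by (simp add: distrib_left)
qed

lemma query_point_extrapolation:
  assumes "1 \<le> t"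
  shows "((real t + 1) * (real t + 2) / 2) *\<^sub>R xu (t + 1)
    = (real t * (real t + 1) / 2) *\<^sub>R xu t + (real t + 1) *\<^sub>R x (int t)
      + real t *\<^sub>R (x (int t) - x (int (t - 1)))"
proof -
  have index: "int (t + 1) - 1 = int t" "int (t + 1) - 2 = int (t - 1)"
    using assms by auto
  have \<tau>_next: "\<tau> (t + 1) = real t / 2"
    using \<tau>[of "t + 1"] by simp
  have xu: "xu (t + 1) = ((real t / 2) *\<^sub>R xu t + (x (int t)
      + (real t / (real t + 1)) *\<^sub>R (x (int t) - x (int (t - 1))))) /\<^sub>R (1 + real t / 2)"
    using query_point[of "t + 1"]
    unfolding index \<tau>_next \<theta>[OF assms] add_diff_cancel_right' by simp
  have "((real t + 1) * (real t + 2) / 2) *\<^sub>R xu (t + 1)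
      = (real t + 1) *\<^sub>R ((1 + real t / 2) *\<^sub>R xu (t + 1))"
    by (simp add: field_simps)
  also have "(1 + real t / 2) *\<^sub>R xu (t + 1) = (real t / 2) *\<^sub>R xu t + (x (int t)
      + (real t / (real t + 1)) *\<^sub>R (x (int t) - x (int (t - 1))))"
    unfolding xu by (simp add: add_pos_nonneg less_imp_neq[THEN not_sym])
  also have "(real t + 1) *\<^sub>R \<dots> = (real t * (real t + 1) / 2) *\<^sub>R xu t
      + (real t + 1) *\<^sub>R x (int t) + real t *\<^sub>R (x (int t) - x (int (t - 1)))"
    by (simp add: scaleR_right_distrib add.commute[of 1] mult.commute)
  finally show ?thesis .
qed

text \<open>
  The movement of the phase outputs is charged by the acceleration estimate and paid by the
  proximity terms of the inner loops.
\<close>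

lemma lagrangian_gap:
  assumes N: "1 \<le> N" and l: "0 \<le> l"
    and lipschitz: "L-lipschitz_on UNIV (\<lambda>z. gf z + l v* J z)"
  defines "xbar \<equiv> acgd_s_output real x N"
  shows "real N * (real N + 1) / 2 * (f xbar + u xbar + l \<bullet> g xbar - (f xs + u xs))
    \<le> 3 / 2 * L * (norm (x0 - xs))\<^sup>2 + L / (2 * R\<^sup>2) * (norm l)\<^sup>2"
proof -
  define h where "h z = f z + l \<bullet> g z" for z
  define G where "G z = gf z + l v* J z" for z
  define W where "W = (\<Sum>t=1..N. real t)"
  have W: "W = real N * (real N + 1) / 2"
    unfolding W_def by (induction N) (simp_all add: field_simps)
  have W_pos: "0 < W"
    unfolding W using N by (intro divide_pos_pos mult_pos_pos) auto
  have "h a + G a \<bullet> (b - a) + (norm (G b - G a))\<^sup>2 / (2 * L) \<le> h b" for a b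
    unfolding h_def G_def
    by (rule cocoercive_tangent) (fact convex_on_lagrangian[OF f(1) g(1) l]
        has_derivative_lagrangian[OF f(2) g(2)] lipschitz positive)+
  moreover have "xu 1 = x (int 0)"
    using query_point[of 1] \<tau>[of 1] initial by simp
  ultimately have accelerated: "(\<Sum>t=1..N. real t * (h xbar + G xbar \<bullet> (x (int t) - xbar)))
      \<le> (\<Sum>t=1..N. real t * (h (xu t) + G (xu t) \<bullet> (x (int t) - xu t)))
        + L * (\<Sum>t=1..N. (norm (x (int t) - x (int (t - 1))))\<^sup>2)"
    using positive query_point_extrapolation N
    by (intro accelerated_linearization[where p = "\<lambda>t. x (int t)"]) auto
  have average: "xbar = (\<Sum>t=1..N. real t *\<^sub>R x (int t)) /\<^sub>R W"
    by (simp add: xbar_def acgd_s_output_def W_def)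
  \<comment> \<open>The first-order terms at \<open>xbar\<close> cancel because \<open>xbar\<close> is the weighted average.\<close>
  have "(\<Sum>t=1..N. real t *\<^sub>R (x (int t) - xbar)) = 0"
  proof -
    have "(\<Sum>t=1..N. real t *\<^sub>R (x (int t) - xbar))
        = (\<Sum>t=1..N. real t *\<^sub>R x (int t)) - W *\<^sub>R xbar"
      by (simp add: scaleR_diff_right sum_subtractf W_def scaleR_sum_left)
    then show ?thesis
      using W_pos by (simp add: average)
  qed
  then have "(\<Sum>t=1..N. G xbar \<bullet> (real t *\<^sub>R (x (int t) - xbar))) = 0"
    by (metis inner_sum_right inner_zero_right)
  then have "(\<Sum>t=1..N. real t * (h xbar + G xbar \<bullet> (x (int t) - xbar))) = W * h xbar"
    by (simp add: distrib_left sum.distrib W_def sum_distrib_right)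
  moreover have "h (xu t) + G (xu t) \<bullet> (x (int t) - xu t) = linearized l t (x (int t))" for t
    by (simp add: h_def G_def linearized_def inner_add_left inner_add_right dot_lmul_matrix)
  moreover have "(\<Sum>t=1..N. (norm (x (int t) - x (int (t - 1))))\<^sup>2)
      = (\<Sum>t=1..N. (norm (x (int t) - x (int t - 1)))\<^sup>2)"
    by (intro sum.cong) (auto simp: of_nat_diff)
  ultimately have lagrangian: "W * h xbar \<le> (\<Sum>t=1..N. real t * linearized l t (x (int t)))
      + L * (\<Sum>t=1..N. (norm (x (int t) - x (int t - 1)))\<^sup>2)"
    using accelerated by simp
  have "u xbar \<le> (\<Sum>t=1..N. (real t / W) * u (x (int t)))"
  proof -
    have "xbar = (\<Sum>t=1..N. (real t / W) *\<^sub>R x (int t))"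
      by (simp add: average scaleR_sum_right divide_inverse mult.commute)
    moreover have "(\<Sum>t=1..N. real t / W) = 1"
      using W_pos by (simp add: sum_divide_distrib[symmetric] W_def)
    ultimately show ?thesis
      using N W_pos phase_output_mem by (simp only:) (intro convex_on_sum[OF _ _ u], auto)
  qed
  then have "W * u xbar \<le> W * (\<Sum>t=1..N. (real t / W) * u (x (int t)))"
    using W_pos by simp
  also have "\<dots> = (\<Sum>t=1..N. real t * u (x (int t)))"
    using W_pos by (simp add: sum_distrib_left)
  finally have "W * (h xbar + u xbar - (f xs + u xs))
      \<le> (\<Sum>t=1..N. real t * (linearized l t (x (int t)) + u (x (int t)) - (f xs + u xs)))
        + L * (\<Sum>t=1..N. (norm (x (int t) - x (int t - 1)))\<^sup>2)"
    using lagrangian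
    by (simp add: distrib_left right_diff_distrib sum.distrib sum_subtractf W_def
        flip: sum_distrib_right)
  also have "\<dots> \<le> potential l 1 0 - potential l (N + 1) 0
      + L * (norm (xs - x0))\<^sup>2 - L * (norm (xs - x (int N)))\<^sup>2"
    by (rule phases_bound[OF l])
  also have "\<dots> \<le> potential l 1 0 + L * (norm (xs - x0))\<^sup>2"
  proof -
    have "0 \<le> L * (norm (xs - x (int N)))\<^sup>2"
      using positive by simp
    then show ?thesis
      using potential_nonneg[of "N + 1" l 0] by simp
  qed
  also have "potential l 1 0 = L / 2 * (norm (xs - x0))\<^sup>2 + L / (2 * R\<^sup>2) * (norm l)\<^sup>2"
    using initial by (simp add: potential_def pd_potential_def momentum_def)
  finally show ?thesis
    unfolding W h_def by (simp add: norm_minus_commute algebra_simps)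
qed

end

section \<open>Complexity\<close>

theorem corollary3:
  fixes X U B :: "(real ^ 'n) set"
    and f u :: "real ^ 'n \<Rightarrow> real"
    and g :: "real ^ 'n \<Rightarrow> real ^ 'm"
    and gf :: "real ^ 'n \<Rightarrow> real ^ 'n"
    and J :: "real ^ 'n \<Rightarrow> real ^ 'n ^ 'm"
    and xs x0 :: "real ^ 'n" and ls :: "real ^ 'm"
    and Lip :: "real ^ 'm \<Rightarrow> real"
    and c \<epsilon> d L D R \<Delta> Mbar :: real
    and \<tau> \<theta> \<eta> \<omega> M Mt :: "nat \<Rightarrow> real"
    and S :: "nat \<Rightarrow> nat"
    and \<rho> \<beta> \<gamma> \<delta> :: "nat \<Rightarrow> nat \<Rightarrow> real"
    and x :: "int \<Rightarrow> real ^ 'n" and xu :: "nat \<Rightarrow> real ^ 'n"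
    and y :: "nat \<Rightarrow> nat \<Rightarrow> real ^ 'n" and lam :: "nat \<Rightarrow> int \<Rightarrow> real ^ 'm"
  defines "F \<equiv> \<lambda>z. f z + u z"
  assumes X: "closed X" "convex X"
    and f: "convex_on UNIV f" "\<And>z. GDERIV f z :> gf z"
      "\<exists>K. K-lipschitz_on UNIV gf"
    and g: "\<And>i. convex_on UNIV (\<lambda>z. g z $ i)"
      "\<And>z. (g has_derivative (\<lambda>h. J z *v h)) (at z)"
      "\<And>i. \<exists>K. K-lipschitz_on UNIV (\<lambda>z. row i (J z))"
    and u: "X \<subseteq> U" "convex_on U u"
    and opt: "optimal_solution X F g xs"
    and kkt: "kkt_pair X gf g J U u xs ls"
    and c: "c \<ge> 1" and eps: "\<epsilon> > 0" and x0: "x0 \<noteq> xs"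
    and Lip: "\<And>l. 0 \<le> l \<Longrightarrow>
        (Lip l)-lipschitz_on UNIV (\<lambda>z. gf z + (\<Sum>i\<in>UNIV. l $ i *\<^sub>R row i (J z)))"
      "bdd_above (Lip ` Lambda_set ls c)"
    and L: "L = Sup (Lip ` Lambda_set ls c)" "L > 0"
    and d: "d = norm ls + c"
    and D: "D = norm (x0 - xs)"
    and R: "R = d / D"
    and outer: "\<And>t. t \<ge> 1 \<Longrightarrow> \<tau> t = (real t - 1) / 2"
      "\<And>t. t \<ge> 1 \<Longrightarrow> \<eta> t = L / \<tau> (t + 1)"
      "\<And>t. t \<ge> 1 \<Longrightarrow> \<omega> t = real t"
      "\<And>t. t \<ge> 1 \<Longrightarrow> \<theta> (t + 1) = \<omega> t / \<omega> (t + 1)"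
    and M: "\<And>t. t \<ge> 1 \<Longrightarrow> M t = (if mat_norm (J (xu t)) > 0 then mat_norm (J (xu t)) else 1)"
    and Delta: "\<Delta> = R / L"
    and S: "\<And>t. t \<ge> 1 \<Longrightarrow> S t = nat \<lceil>M t * \<Delta> * real t\<rceil>"
    and Mt: "\<And>t. t \<ge> 1 \<Longrightarrow> Mt t = real (S t) / (\<Delta> * real t)"
    and inner: "\<And>t. t \<ge> 2 \<Longrightarrow> \<rho> t 1 = Mt t / Mt (t - 1)"
      "\<And>t s. t \<ge> 1 \<Longrightarrow> s \<ge> 2 \<or> (s = 1 \<and> t = 1) \<Longrightarrow> \<rho> t s = 1"
      "\<And>t s. t \<ge> 1 \<Longrightarrow> s \<ge> 1 \<Longrightarrow> \<beta> t s = Mt t * R"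
      "\<And>t s. t \<ge> 1 \<Longrightarrow> s \<ge> 1 \<Longrightarrow> \<gamma> t s = Mt t / R"
      "\<And>t s. t \<ge> 1 \<Longrightarrow> s \<ge> 1 \<Longrightarrow> \<delta> t s = 1"
    and run: "acgd_s X gf g J u x0 \<tau> \<theta> \<eta> S \<rho> \<beta> \<gamma> \<delta> x xu y lam"
    and Mbar: "bounded B" "xs \<in> interior B" "\<And>t. t \<ge> 1 \<Longrightarrow> xu t \<in> B"
      "\<And>z. z \<in> B \<Longrightarrow> max 1 (mat_norm (J z)) \<le> Mbar"
    and nontrivial: "\<not> eps_optimal F g (F xs) \<epsilon> (\<epsilon> / c) x0"
  shows "\<exists>N\<ge>1. eps_optimal F g (F xs) \<epsilon> (\<epsilon> / c) (acgd_s_output \<omega> x N) \<and>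
      real (oracle_evaluations N) \<le> max 1 (10 * (sqrt (L / \<epsilon>) * D)) \<and>
      real (matvec_multiplications S N)
        \<le> 50 * (max 1 (sqrt (L / \<epsilon>) * D) + d * Mbar / (L * D) + d * Mbar * D / \<epsilon>)"
proof -
  have D_pos: "0 < D"
    using x0 D by simp
  have d_pos: "0 < d"
    using c d by (simp add: add_nonneg_pos)
  have R_pos: "0 < R"
    using R D_pos d_pos by simp
  have \<Delta>_pos: "0 < \<Delta>"
    using Delta R_pos L(2) by simp
  have M_pos: "0 < M t" and norm_le_M: "mat_norm (J (xu t)) \<le> M t" and M_le: "M t \<le> Mbar"
    if "1 \<le> t" for t
    using M[OF that] Mbar(4)[OF Mbar(3)[OF that]] by auto
  have S_pos: "1 \<le> S t" and S_ge: "M t * \<Delta> * real t \<le> real (S t)"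
    and S_le: "real (S t) \<le> Mbar * \<Delta> * real t + 1" if "1 \<le> t" for t
  proof -
    \<comment> \<open>A vanishing Jacobian has \<open>M t = 1\<close>, so every phase makes at least one inner iteration.\<close>
    have pos: "0 < M t * \<Delta> * real t"
      using M_pos[OF that] \<Delta>_pos that by simp
    then show "1 \<le> S t"
      unfolding S[OF that] by linarith
    show "M t * \<Delta> * real t \<le> real (S t)"
      unfolding S[OF that] by (rule real_nat_ceiling_ge)
    have "real (S t) \<le> M t * \<Delta> * real t + 1"
      unfolding S[OF that] using pos by linarith
    also have "M t * \<Delta> * real t \<le> Mbar * \<Delta> * real t"
      using M_le[OF that] \<Delta>_pos by (intro mult_right_mono) auto
    finally show "real (S t) \<le> Mbar * \<Delta> * real t + 1"
      by simp
  qed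
  have Mt_eq: "Mt t = L / R / (real t / S t)" if "1 \<le> t" for t
    unfolding Mt[OF that] Delta by simp
  have xs: "xs \<in> X" "g xs \<le> 0" "0 \<le> ls"
    using kkt by (auto simp: kkt_pair_def)
  interpret run: acgd_s_run X f u g gf J xs x0 L R \<tau> \<theta> \<eta> S \<rho> \<beta> \<gamma> \<delta> x xu y lam
  proof
    show "convex_on X u"
      using u X(2) by (auto intro: convex_on_subset)
    fix t s :: nat
    assume t: "1 \<le> t"
    show "\<theta> (t + 1) = real t / (real t + 1)"
      using outer(3)[of t] outer(3)[of "t + 1"] outer(4)[OF t] t by simp
    have \<tau>_next: "\<tau> (t + 1) = real t / 2"
      using outer(1)[of "t + 1"] by simp
    show "\<eta> t = 2 * L / real t"
      unfolding outer(2)[OF t] \<tau>_next by simp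
    have "\<rho> (t + 1) 1 = Mt (t + 1) / Mt t"
      using inner(1)[of "t + 1"] t by simp
    also have "\<dots> = (L / R / (real (t + 1) / S (t + 1))) / (L / R / (real t / S t))"
      by (simp only: Mt_eq[OF t] Mt_eq[of "t + 1"] le_add2)
    also have "\<dots> = (real t / S t) / (real (t + 1) / S (t + 1))"
      using L(2) R_pos by (simp add: mult.commute)
    finally show "\<rho> (t + 1) 1 = (real t / S t) / (real (t + 1) / S (t + 1))" .
    show "mat_norm (J (xu t)) \<le> real (S t) * L / (R * real t)"
    proof -
      have "M t * (R / L * real t) \<le> real (S t)"
        using S_ge[OF t] by (simp add: Delta mult.assoc)
      then have "M t \<le> real (S t) * L / (R * real t)"
        using L(2) R_pos t by (simp add: field_simps)
      then show ?thesis
        using norm_le_M[OF t] by linarith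
    qed
    assume s: "1 \<le> s"
    show "\<beta> t s = L / (real t / S t)"
      using inner(3)[OF t s] Mt_eq[OF t] R_pos by simp
    show "\<gamma> t s = L / R\<^sup>2 / (real t / S t)"
      using inner(4)[OF t s] Mt_eq[OF t] by (simp add: power2_eq_square)
  qed (use f(1,2) g(1,2) xs L(2) R_pos outer(1) inner(2,5) run S_pos in auto)
  define q where "q = sqrt (L / \<epsilon>) * D"
  have q_pos: "0 < q"
    using L(2) eps D_pos by (simp add: q_def)
  have q_square: "q\<^sup>2 = L * D\<^sup>2 / \<epsilon>"
    using L(2) eps by (simp add: q_def power_mult_distrib)
  \<comment> \<open>The least \<open>N\<close> for which \<open>4 L D\<^sup>2 / N\<^sup>2 \<le> \<epsilon>\<close>.\<close>
  define N where "N = nat \<lceil>2 * q\<rceil>"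
  have N: "1 \<le> N" "2 * q \<le> real N" "real N \<le> 2 * q + 1"
    using q_pos unfolding N_def by linarith+
  define xbar where "xbar = acgd_s_output \<omega> x N"
  have xbar: "xbar = acgd_s_output real x N"
    using outer(3) by (simp add: xbar_def acgd_s_output_def)
  have "xbar \<in> X"
    unfolding xbar by (rule run.output_mem[OF N(1)])
  have gap: "F xbar + l \<bullet> g xbar - F xs \<le> \<epsilon>" if l: "l \<in> Lambda_set ls c" for l
  proof -
    have "0 \<le> l" and "norm l \<le> d"
      using l xs(3) c
      by (auto simp: Lambda_set_def d add_nonneg_nonneg intro: norm_triangle_le)
    have "Lip l \<le> L"
      unfolding L(1) using Lip(2) l by (intro cSup_upper) auto
    then have "L-lipschitz_on UNIV (\<lambda>z. gf z + l v* J z)"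
      using lipschitz_on_le[OF Lip(1)[OF \<open>0 \<le> l\<close>]] by (simp add: sum_scaleR_row_eq)
    from run.lagrangian_gap[OF N(1) \<open>0 \<le> l\<close> this]
    have "real N * (real N + 1) / 2 * (F xbar + l \<bullet> g xbar - F xs)
        \<le> 3 / 2 * L * D\<^sup>2 + L / (2 * R\<^sup>2) * (norm l)\<^sup>2"
      by (simp add: xbar F_def D algebra_simps)
    also have "L / (2 * R\<^sup>2) * (norm l)\<^sup>2 \<le> L / (2 * R\<^sup>2) * d\<^sup>2"
      using \<open>norm l \<le> d\<close> L(2) by (intro mult_left_mono power_mono) auto
    also have "L / (2 * R\<^sup>2) * d\<^sup>2 = L * D\<^sup>2 / 2"
      using R D_pos d_pos by (simp add: power_divide)
    also have "3 / 2 * L * D\<^sup>2 + L * D\<^sup>2 / 2 = (2 * q)\<^sup>2 / 2 * \<epsilon>"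
      using eps by (simp add: power_mult_distrib q_square)
    also have "\<dots> \<le> real N * (real N + 1) / 2 * \<epsilon>"
    proof -
      have "(2 * q)\<^sup>2 \<le> (real N)\<^sup>2"
        using N(2) q_pos by (intro power_mono) auto
      also have "\<dots> \<le> real N * (real N + 1)"
        by (simp add: power2_eq_square algebra_simps)
      finally show ?thesis
        using eps by simp
    qed
    finally show ?thesis
      using N(1) by (simp add: mult_le_cancel_left_pos)
  qed
  have optimality: "F xbar - F xs \<le> \<epsilon>"
    using gap[of 0] by (simp add: Lambda_set_def)
  \<comment> \<open>The test multiplier exceeds \<open>ls\<close> by \<open>c\<close> in the direction of the violated constraints.\<close>
  define v where "v = pos_part (g xbar)"
  have feasibility: "norm v \<le> \<epsilon> / c"
  proof (cases "v = 0")
    case True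
    then show ?thesis
      using eps c by simp
  next
    case False
    have "0 \<le> v"
      by (simp add: v_def pos_part_def less_eq_vec_def)
    then have "0 \<le> (c / norm v) *\<^sub>R v"
      using c by (simp add: less_eq_vec_def)
    then have "ls + (c / norm v) *\<^sub>R v \<in> Lambda_set ls c"
      using False c unfolding Lambda_set_def by auto
    from gap[OF this] have "F xbar + ls \<bullet> g xbar + c / norm v * (v \<bullet> g xbar) - F xs \<le> \<epsilon>"
      by (simp add: inner_simps algebra_simps)
    moreover have "c / norm v * (v \<bullet> g xbar) = c * norm v"
      using False by (simp add: v_def inner_pos_part power2_eq_square)
    moreover have "F xs \<le> F xbar + ls \<bullet> g xbar"
      unfolding F_def using kkt_pair_lagrangian_minimum[OF f(1,2) g(1,2) kkt \<open>xbar \<in> X\<close>]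
        \<open>xbar \<in> X\<close> u(1) by auto
    ultimately have "c * norm v \<le> \<epsilon>"
      by linarith
    then show ?thesis
      using c by (simp add: field_simps)
  qed
  \<comment> \<open>If \<open>2 q \<le> 1\<close> then \<open>N = 1\<close>; otherwise the rounding at most doubles \<open>2 q\<close>.\<close>
  have evaluations: "real (oracle_evaluations N) \<le> max 1 (10 * q)"
  proof (cases "2 * q \<le> 1")
    case True
    then have "N \<le> 1"
      unfolding N_def by linarith
    then show ?thesis
      by (simp add: oracle_evaluations_def)
  next
    case False
    then show ?thesis
      using N(3) by (simp add: oracle_evaluations_def)
  qed
  have matvec: "real (matvec_multiplications S N)
      \<le> 50 * (max 1 q + d * Mbar / (L * D) + d * Mbar * D / \<epsilon>)"
  proof -
    define K where "K = Mbar * \<Delta>"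
    have K: "0 \<le> K" "K = d * Mbar / (L * D)"
      using M_pos[of 1] M_le[of 1] \<Delta>_pos by (simp add: K_def) (simp add: K_def Delta R mult.commute)
    have Kq: "K * q\<^sup>2 = d * Mbar * D / \<epsilon>"
      unfolding K(2) q_square using L(2) D_pos by (simp add: power2_eq_square)
    \<comment> \<open>Rounding up \<open>S t\<close> adds at most one iteration per phase, hence the summand \<open>N\<close>.\<close>
    have "real (matvec_multiplications S N) = 3 * (\<Sum>t=1..N. real (S t))"
      by (simp add: matvec_multiplications_def sum_distrib_left mult.commute)
    also have "\<dots> \<le> 3 * (\<Sum>t=1..N. K * real t + 1)"
      using S_le by (intro mult_left_mono sum_mono) (auto simp: K_def)
    also have "(\<Sum>t=1..N. K * real t + 1) = K * (real N * (real N + 1) / 2) + real N"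
      by (induction N) (simp_all add: field_simps)
    also have "K * (real N * (real N + 1) / 2) \<le> K * ((7 * q\<^sup>2 + 5) / 2)"
    proof -
      have "real N * (real N + 1) \<le> (2 * q + 1) * (2 * q + 1 + 1)"
        using N(3) q_pos by (intro mult_mono) auto
      also have "\<dots> = 4 * q\<^sup>2 + 6 * q + 2"
        by (simp add: power2_eq_square algebra_simps)
      also have "\<dots> \<le> 7 * q\<^sup>2 + 5"
        using zero_le_power2[of "q - 1"] by (simp add: power2_eq_square algebra_simps)
      finally show ?thesis
        using K(1) by (intro mult_left_mono) auto
    qed
    also have "3 * (K * ((7 * q\<^sup>2 + 5) / 2) + real N) \<le> 50 * (max 1 q + K + K * q\<^sup>2)"
    proof -
      have "0 \<le> K * q\<^sup>2"
        using K(1) by simp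
      moreover have "K * ((7 * q\<^sup>2 + 5) / 2) = 7 / 2 * (K * q\<^sup>2) + 5 / 2 * K"
        by (simp add: algebra_simps)
      moreover have "real N \<le> 3 * max 1 q"
        using N(3) by linarith
      moreover have "0 \<le> max 1 q"
        by simp
      ultimately show ?thesis
        using K(1) unfolding distrib_left by linarith
    qed
    finally show ?thesis
      unfolding Kq K(2)[symmetric] by simp
  qed
  show ?thesis
    using N(1) optimality feasibility evaluations matvec
    unfolding eps_optimal_def v_def xbar_def q_def by blast
qed

end
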